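(* Let $n\ge 3$ and $r\ge 1$ be integers, and let $G$ be a finite simple connected graph with $N_0$ vertices and $E_0$ edges. Let $CL_r(G)$ be the $r$-th clique-blew up iterative graph of $G$. Then the multiplicative degree-Kirchhoff index of $CL_r(G)$ is $$\begin{aligned} Kf^{*}(CL_r(G))=&\frac{n^r (n-1)^{2r}}{2^r}Kf^{*}(G)-\frac{n^{r-1}(n-1)^{2r+1}}{2^r}\left(1-\frac{1}{(n-1)^r}\right)E_0N_0\\ &+\frac{(n-1)^{2r} n^{r-1}}{2^{r-1}}\left(3\left(\frac{n^r}{2^r}-1\right)-\frac{1}{n+1}\left(\frac{n^r}{2^{r-1}}+\frac{1}{(n-1)^{r-1}}-n-1\right)\right)E_0^2. \end{aligned}$$
   Context: Clique-blew up graph: fix an integer $n\ge 3$. For a graph $G$, the graph $CL(G)$ is obtained from $G$ by adding, for every edge $e$ of $G$, $n-2$ new vertices (distinct edges receive disjoint sets of new vertices) and the edges needed so that these new vertices together with the two end-vertices of $e$ form a complete graph $K_n$. Iterates: $CL_0(G)=G$ and $CL_r(G)=CL(CL_{r-1}(G))$ for $r\ge1$ (with the same $n$ at every step). Multiplicative degree-Kirchhoff index: for a connected graph $H$, $Kf^{*}(H)=\sum_{i<j}d_id_jr_{ij}$, the sum being over all unordered pairs of vertices, where $d_i$ is the degree of vertex $i$ and $r_{ij}$ is the resistance distance between $i$ and $j$, i.e. the effective electrical resistance between $i$ and $j$ when every edge of $H$ is a unit resistor. *)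

theory Defs
  imports Complex_Main "HOL-Library.Uprod" "Graph_Theory.Graph_Theory"
begin

text \<open>
  A finite simple graph is a \<^locale>\<open>pair_graph\<close>: a finite vertex set with a symmetric,
  irreflexive set of arcs, so that each undirected edge $uv$ is present as the two arcs
  $(u,v)$ and $(v,u)$.
\<close>

definition uedges :: "'a pair_pre_digraph \<Rightarrow> 'a uprod set" where
  "uedges G = (\<lambda>(u, v). Upair u v) ` parcs G"

definition vertex_degree :: "'a pair_pre_digraph \<Rightarrow> 'a \<Rightarrow> nat" where
  "vertex_degree G v = out_degree (with_proj G) v"

text \<open>
  The iterates of the blow-up live on one vertex type. Every step wraps the vertices of the
  graph it is applied to in \<open>Old\<close>, so the new vertices \<open>New e k\<close> are always fresh, even though
  an edge $e$ survives the step and is blown up again in the next one.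
\<close>

datatype 'a clvertex =
    Base 'a
  | Old "'a clvertex"
  | New "'a clvertex uprod" nat

definition new_verts :: "nat \<Rightarrow> 'a clvertex uprod \<Rightarrow> 'a clvertex set" where
  "new_verts n e = New e ` {..<n - 2}"

definition CL :: "nat \<Rightarrow> 'a clvertex pair_pre_digraph \<Rightarrow> 'a clvertex pair_pre_digraph" where
  "CL n G =
    \<lparr> pverts = Old ` pverts G \<union> (\<Union>e\<in>uedges G. new_verts n e),
      parcs = map_prod Old Old ` parcs G \<union>
        (\<Union>e\<in>uedges G. {(x, y). x \<in> Old ` set_uprod e \<union> new_verts n e \<and>
                              y \<in> Old ` set_uprod e \<union> new_verts n e \<and> x \<noteq> y}) \<rparr>"

primrec CL_iter :: "nat \<Rightarrow> nat \<Rightarrow> 'a pair_pre_digraph \<Rightarrow> 'a clvertex pair_pre_digraph" where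
  "CL_iter n 0 G = \<lparr> pverts = Base ` pverts G, parcs = map_prod Base Base ` parcs G \<rparr>"
| "CL_iter n (Suc r) G = CL n (CL_iter n r G)"

text \<open>
  \<open>p\<close> is an electrical potential when all edges are unit resistors and a unit current enters
  the network at \<open>i\<close> and leaves it at \<open>j\<close>: by Ohm's law the current along an edge $xy$ is
  $p(x) - p(y)$, and Kirchhoff's current law holds at every vertex.
\<close>

definition unit_current_potential :: "'a pair_pre_digraph \<Rightarrow> 'a \<Rightarrow> 'a \<Rightarrow> ('a \<Rightarrow> real) \<Rightarrow> bool" where
  "unit_current_potential G i j p \<longleftrightarrow>
    (\<forall>x\<in>pverts G. (\<Sum>y | (x, y) \<in> parcs G. p x - p y) = of_bool (x = i) - of_bool (x = j))"

text \<open>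
  The effective resistance is the resulting potential difference. In a finite connected graph
  such a potential exists and is unique up to an additive constant.
\<close>

definition resistance :: "'a pair_pre_digraph \<Rightarrow> 'a \<Rightarrow> 'a \<Rightarrow> real" where
  "resistance G i j = (THE R. \<exists>p. unit_current_potential G i j p \<and> R = p i - p j)"

text \<open>
  The sum ranges over the ordered pairs of distinct vertices, in which every unordered pair occurs
  twice; hence the factor $1/2$.
\<close>

definition Kf_mult :: "'a pair_pre_digraph \<Rightarrow> real" where
  "Kf_mult G =
    (\<Sum>i\<in>pverts G. \<Sum>j\<in>pverts G - {i}.
        real (vertex_degree G i) * real (vertex_degree G j) * resistance G i j) / 2"

end

theory Submission
  imports Defs "Jordan_Normal_Form.Determinant"
begin

text \<open>
  Everything is expressed through a Green function of the network: a family of potentials \<open>g i\<close>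
  such that \<open>g i\<close> is driven by a unit current entering at \<open>i\<close> and leaving at a common ground
  vertex \<open>z\<close>. By superposition the resistance is \<open>g i i - g i j - g j i + g j j\<close>, so with $d$ the
  degree function $Kf^*$ is $2 E \sum_i d_i\, g_i(i) - \sum_{i,j} d_i d_j\, g_i(j)$
  (\<open>Kf_mult_green\<close>). The mere existence of a Green function already forces potentials to be unique
  up to a constant, because the Laplacian is self-adjoint. So it suffices to have
  one for every iterate: for the initial graph it comes from connectedness, which makes the grounded
  Laplacian invertible (\<open>green_exists\<close>), and a blow-up step turns one into the next.

  The Green function of the blow-up is explicit (\<open>green_CL\<close>). Eliminating the new vertices of a clique
  on the edge $uv$ replaces the clique by a resistor of size $2/n$ between $u$ and $v$; current
  injected at a new vertex splits evenly between $u$ and $v$; and a new vertex floats at the mean of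
  the potentials at $u$ and $v$, apart from a correction confined to the cliques whose new vertices
  carry injected current. The new Green function is therefore $2/n$ times the extension of the old
  one by edge means in both arguments, plus a term supported on pairs of new vertices of one clique.

  Degree-weighted sums of such extensions reduce to degree-weighted sums on the old graph, since the
  sum over all edges of the mean of $f$ over the end-vertices is $\frac12\sum_a d_a f(a)$. In the
  diagonal sum the entries $g_a(b)$ with $ab$ an edge occur as well; these are controlled by Foster's
  theorem (\<open>foster_theorem\<close>) and contribute the term with the number of vertices. The outcome is
  \<open>Kf_mult_CL\<close>, the recursion
  \[ Kf^*(CL(G)) = \tfrac{n(n-1)^2}{2} Kf^*(G) - \tfrac{(n-1)^2(n-2)}{2} E N
      + \tfrac{3(n-1)^2(n-2)}{2} E^2 , \]
  which is solved together with those for $N$ and $E$ by induction on the number of steps, starting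
  from no step at all.
\<close>


section \<open>Solvability of linear systems indexed by a finite set\<close>

text \<open>
  This is injectivity implying surjectivity for an endomorphism of a finite-dimensional space.
  An enumeration of the index set transports the system to a square matrix.
\<close>

lemma linear_system_solvable:
  fixes A :: "'a \<Rightarrow> 'a \<Rightarrow> real"
  assumes fin: "finite S"
    and ker: "\<And>f j. (\<And>i. i \<in> S \<Longrightarrow> (\<Sum>j\<in>S. A i j * f j) = 0) \<Longrightarrow> j \<in> S \<Longrightarrow> f j = 0"
  obtains f where "\<And>i. i \<in> S \<Longrightarrow> (\<Sum>j\<in>S. A i j * f j) = b i"
proof -
  obtain h where h: "bij_betw h {0..<card S} S"
    using ex_bij_betw_nat_finite[OF fin] by blast
  define n where "n = card S"
  define k where "k = the_inv_into {0..<n} h"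
  have kh: "k (h i) = i" if "i < n" for i
    using h that unfolding k_def n_def bij_betw_def by (simp add: the_inv_into_f_f)
  have S: "S = h ` {0..<n}" using h unfolding n_def bij_betw_def by simp
  define M where "M = mat n n (\<lambda>(i, j). A (h i) (h j))"
  have M: "M \<in> carrier_mat n n" by (simp add: M_def)
  have apply_M: "(\<Sum>j\<in>S. A (h i) j * v $ k j) = (M *\<^sub>v v) $ i"
    if "i < n" "v \<in> carrier_vec n" for i v
  proof -
    have "(\<Sum>j\<in>S. A (h i) j * v $ k j) = (\<Sum>j\<in>{0..<n}. A (h i) (h j) * v $ k (h j))"
      using h by (intro sum.reindex_bij_betw[symmetric]) (simp add: n_def)
    also have "\<dots> = (\<Sum>j\<in>{0..<n}. A (h i) (h j) * v $ j)"
      by (intro sum.cong) (simp_all add: kh)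
    also have "\<dots> = (M *\<^sub>v v) $ i"
      using that by (simp add: M_def scalar_prod_def)
    finally show ?thesis .
  qed
  have "det M \<noteq> 0"
  proof
    assume "det M = 0"
    then obtain v where v: "v \<in> carrier_vec n" "v \<noteq> 0\<^sub>v n" "M *\<^sub>v v = 0\<^sub>v n"
      using det_0_iff_vec_prod_zero_field[OF M] by blast
    have "v $ k j = 0" if "j \<in> S" for j
      by (rule ker[OF _ that]) (use S v apply_M[OF _ v(1)] in auto)
    then have "v $ i = 0" if "i < n" for i
      using that S kh by force
    then have "v = 0\<^sub>v n" using v(1) by (intro eq_vecI) auto
    with v(2) show False by simp
  qed
  from det_non_zero_imp_unit[OF M this, where b = "()"]
  obtain B where B: "B \<in> carrier_mat n n" "M * B = 1\<^sub>m n"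
    unfolding Units_def ring_mat_def by auto
  define v where "v = B *\<^sub>v vec n (b \<circ> h)"
  have v: "v \<in> carrier_vec n" using B by (simp add: v_def)
  have "M *\<^sub>v v = (M * B) *\<^sub>v vec n (b \<circ> h)"
    unfolding v_def by (rule assoc_mult_mat_vec[symmetric, OF M B(1)]) simp
  then have Mv: "M *\<^sub>v v = vec n (b \<circ> h)" by (simp add: B(2))
  have "(\<Sum>j\<in>S. A i j * v $ k j) = b i" if "i \<in> S" for i
  proof -
    from that S obtain i' where "i = h i'" "i' < n" by auto
    then show ?thesis using apply_M[OF _ v] Mv by simp
  qed
  then show thesis by (rule that)
qed

section \<open>The graph Laplacian\<close>

definition nbrs :: "'a pair_pre_digraph \<Rightarrow> 'a \<Rightarrow> 'a set" where
  "nbrs P x = {y. (x, y) \<in> parcs P}"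

definition laplacian :: "'a pair_pre_digraph \<Rightarrow> ('a \<Rightarrow> real) \<Rightarrow> 'a \<Rightarrow> real" where
  "laplacian P f x = (\<Sum>y\<in>nbrs P x. f x - f y)"

lemma unit_current_potential_laplacian:
  "unit_current_potential P i j p \<longleftrightarrow>
    (\<forall>x\<in>pverts P. laplacian P p x = of_bool (x = i) - of_bool (x = j))"
  by (simp add: unit_current_potential_def laplacian_def nbrs_def)

lemma vertex_degree_nbrs: "vertex_degree P x = card (nbrs P x)"
proof -
  have "out_arcs (with_proj P) x = Pair x ` nbrs P x"
    by (auto simp: out_arcs_def nbrs_def)
  then show ?thesis
    by (simp add: vertex_degree_def out_degree_def card_image inj_on_def)
qed

lemma laplacian_linear:
  "laplacian P (\<lambda>x. a * f x + b * g x) x = a * laplacian P f x + b * laplacian P g x"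
  by (simp add: laplacian_def sum_distrib_left sum.distrib[symmetric] algebra_simps)

lemma laplacian_diff: "laplacian P (\<lambda>x. f x - g x) x = laplacian P f x - laplacian P g x"
  using laplacian_linear[of P 1 f "-1" g x] by simp

context pair_graph
begin

lemma nbrs_sym: "y \<in> nbrs G x \<longleftrightarrow> x \<in> nbrs G y"
  using pair_sym_arcs by (auto simp: nbrs_def symmetric_def sym_def)

lemma nbrs_in_verts: "y \<in> nbrs G x \<Longrightarrow> y \<in> pverts G" "y \<in> nbrs G x \<Longrightarrow> x \<in> pverts G"
  by (auto simp: nbrs_def dest: in_arcsD1 in_arcsD2)

lemma not_in_own_nbrs: "x \<notin> nbrs G x"
  using pair_no_loops by (fastforce simp: nbrs_def)

lemma finite_nbrs [simp]: "finite (nbrs G x)"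
  by (rule finite_subset[OF _ pair_finite_verts]) (auto dest: nbrs_in_verts)

text \<open>
  Reversing all arcs permutes them, since the graph is symmetric.
\<close>

lemma sum_arcs_swap:
  fixes F :: "'a \<Rightarrow> 'a \<Rightarrow> real"
  shows "(\<Sum>x\<in>pverts G. \<Sum>y\<in>nbrs G x. F x y) = (\<Sum>x\<in>pverts G. \<Sum>y\<in>nbrs G x. F y x)"
proof -
  have nb: "nbrs G x = {y. y \<in> pverts G \<and> y \<in> nbrs G x}" for x
    using nbrs_in_verts by blast
  have nb': "{x. x \<in> pverts G \<and> y \<in> nbrs G x} = nbrs G y" for y
    using nbrs_in_verts nbrs_sym by blast
  have "(\<Sum>x\<in>pverts G. \<Sum>y\<in>nbrs G x. F x y)
      = (\<Sum>x\<in>pverts G. \<Sum>y | y \<in> pverts G \<and> y \<in> nbrs G x. F x y)"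
    by (intro sum.cong refl nb)
  also have "\<dots> = (\<Sum>y\<in>pverts G. \<Sum>x | x \<in> pverts G \<and> y \<in> nbrs G x. F x y)"
    by (rule sum.swap_restrict) (rule pair_finite_verts)+
  also have "\<dots> = (\<Sum>x\<in>pverts G. \<Sum>y\<in>nbrs G x. F y x)"
    by (intro sum.cong refl nb')
  finally show ?thesis .
qed

text \<open>
  Discrete integration by parts: average the sum over the arcs with its reversal. It gives both the
  self-adjointness of the Laplacian and the positivity of the energy.
\<close>

lemma green_identity:
  "(\<Sum>x\<in>pverts G. g x * laplacian G f x)
    = (\<Sum>x\<in>pverts G. \<Sum>y\<in>nbrs G x. (g x - g y) * (f x - f y)) / 2"
proof -
  have "(\<Sum>x\<in>pverts G. g x * laplacian G f x)
      = (\<Sum>x\<in>pverts G. \<Sum>y\<in>nbrs G x. g x * (f x - f y))"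
    by (simp add: laplacian_def sum_distrib_left)
  moreover have "\<dots> = (\<Sum>x\<in>pverts G. \<Sum>y\<in>nbrs G x. g y * (f y - f x))"
    by (rule sum_arcs_swap)
  moreover have "(\<Sum>x\<in>pverts G. \<Sum>y\<in>nbrs G x. (g x - g y) * (f x - f y))
      = (\<Sum>x\<in>pverts G. \<Sum>y\<in>nbrs G x. g x * (f x - f y))
        + (\<Sum>x\<in>pverts G. \<Sum>y\<in>nbrs G x. g y * (f y - f x))"
    by (simp add: sum.distrib[symmetric] algebra_simps)
  ultimately show ?thesis by simp
qed

lemma laplacian_self_adjoint:
  "(\<Sum>x\<in>pverts G. g x * laplacian G f x) = (\<Sum>x\<in>pverts G. f x * laplacian G g x)"
  by (simp add: green_identity mult.commute)

lemma sum_laplacian: "(\<Sum>x\<in>pverts G. laplacian G f x) = 0"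
  using green_identity[of "\<lambda>_. 1" f] by simp

end

section \<open>Green functions, resistances and the index\<close>

text \<open>
  The argument \<open>g i\<close> is the potential of a unit current from \<open>i\<close> to the ground vertex \<open>z\<close>; in
  particular \<open>g z\<close> is harmonic. Each \<open>g i\<close> is determined only up to a constant of its own; these
  constants cancel in the formulas below for the resistance, for the index and in Foster's theorem.
\<close>

definition green_function :: "'a pair_pre_digraph \<Rightarrow> 'a \<Rightarrow> ('a \<Rightarrow> 'a \<Rightarrow> real) \<Rightarrow> bool" where
  "green_function P z g \<longleftrightarrow> z \<in> pverts P \<and>
    (\<forall>i\<in>pverts P. \<forall>x\<in>pverts P. laplacian P (g i) x = of_bool (x = i) - of_bool (x = z))"

context pair_graph
begin

text \<open>
  The difference of \<open>g i\<close> and \<open>g j\<close> is a unit current potential from \<open>i\<close> to \<open>j\<close>. Potentials are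
  unique up to a constant: pairing a harmonic \<open>f\<close> with \<open>g k\<close> and moving the Laplacian over to \<open>f\<close>
  yields \<open>f k = f z\<close>.
\<close>

lemma resistance_green:
  assumes green: "green_function G z g" and ij: "i \<in> pverts G" "j \<in> pverts G"
  shows "resistance G i j = g i i - g i j - g j i + g j j"
proof -
  let ?p = "\<lambda>x. g i x - g j x"
  have p: "unit_current_potential G i j ?p"
    using green ij by (simp add: unit_current_potential_laplacian laplacian_diff green_function_def)
  have diff: "p i - p j = ?p i - ?p j" if p': "unit_current_potential G i j p" for p
  proof -
    define f where "f x = p x - ?p x" for x
    have harmonic: "laplacian G f x = 0" if "x \<in> pverts G" for x
      using p p' that unfolding f_def by (subst laplacian_diff) (simp add: unit_current_potential_laplacian)
    have "f k - f z = 0" if k: "k \<in> pverts G" for k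
    proof -
      have "(\<Sum>x\<in>pverts G. f x * laplacian G (g k) x)
          = (\<Sum>x\<in>pverts G. (if x = k then f x else 0)) - (\<Sum>x\<in>pverts G. (if x = z then f x else 0))"
        unfolding sum_subtractf[symmetric]
        using green k by (intro sum.cong) (auto simp: green_function_def)
      also have "\<dots> = f k - f z"
        using green k by (simp add: green_function_def pair_finite_verts)
      finally show ?thesis
        using laplacian_self_adjoint[of f "g k"] harmonic by simp
    qed
    from this[OF ij(1)] this[OF ij(2)] show ?thesis by (simp add: f_def)
  qed
  have "resistance G i j = ?p i - ?p j"
    unfolding resistance_def using p diff by (intro the_equality) blast+
  then show ?thesis by simp
qed

text \<open>
  The Laplacian is singular, but adding $1$ at the diagonal entry of a vertex \<open>z\<close> makes it positive
  definite on a connected graph: a function of zero energy is constant, and the added entry makes that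
  constant vanish. Solving the modified system with the unit vector at \<open>i\<close> gives \<open>f\<close> with Laplacian
  \<open>e\<^sub>i - f z e\<^sub>z\<close>; as the values of a Laplacian sum to zero, \<open>f z = 1\<close>.
\<close>

lemma green_exists:
  assumes conn: "Digraph_Component.connected (with_proj G)"
  obtains z g where "green_function G z g"
proof -
  have sc: "strongly_connected (with_proj G)"
    by (rule symmetric_connected_imp_strongly_connected[OF pair_sym_arcs conn])
  then obtain z where z: "z \<in> pverts G" by (auto simp: strongly_connected_def)
  \<comment> \<open>The matrix of the Laplacian with the entry at \<open>z\<close> on the diagonal increased by one.\<close>
  define A :: "'a \<Rightarrow> 'a \<Rightarrow> real" where
    "A x y = of_bool (x = y) * (real (card (nbrs G x)) + of_bool (x = z)) - of_bool (y \<in> nbrs G x)"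
    for x y
  have A: "(\<Sum>y\<in>pverts G. A x y * f y) = laplacian G f x + of_bool (x = z) * f z"
    if x: "x \<in> pverts G" for f x
  proof -
    have "(\<Sum>y\<in>pverts G. of_bool (y \<in> nbrs G x) * f y) = (\<Sum>y\<in>nbrs G x. f y)"
      by (rule sum.mono_neutral_cong_right) (auto simp: pair_finite_verts dest: nbrs_in_verts)
    moreover have "(\<Sum>y\<in>pverts G. of_bool (x = y) * (real (card (nbrs G x)) + of_bool (x = z)) * f y)
        = (\<Sum>y\<in>pverts G. if x = y then (real (card (nbrs G x)) + of_bool (x = z)) * f y else 0)"
      by (intro sum.cong) auto
    ultimately show ?thesis
      using x by (auto simp: A_def left_diff_distrib sum_subtractf laplacian_def pair_finite_verts
          algebra_simps)
  qed
  have ker: "f y = 0"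
    if f: "\<And>x. x \<in> pverts G \<Longrightarrow> (\<Sum>y\<in>pverts G. A x y * f y) = 0" and y: "y \<in> pverts G" for f y
  proof -
    have "laplacian G f x = - of_bool (x = z) * f z" if "x \<in> pverts G" for x
      using f[OF that] A[OF that, of f] by simp
    then have "(\<Sum>x\<in>pverts G. f x * laplacian G f x)
        = (\<Sum>x\<in>pverts G. if x = z then - (f z)\<^sup>2 else 0)"
      by (intro sum.cong) (auto simp: power2_eq_square)
    also have "\<dots> = - (f z)\<^sup>2" using z by (simp add: pair_finite_verts)
    finally have eq: "(\<Sum>x\<in>pverts G. \<Sum>y\<in>nbrs G x. (f x - f y)\<^sup>2) = - 2 * (f z)\<^sup>2"
      by (simp add: green_identity power2_eq_square)
    have "0 \<le> (\<Sum>x\<in>pverts G. \<Sum>y\<in>nbrs G x. (f x - f y)\<^sup>2)"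
      by (intro sum_nonneg) simp
    with eq have fz: "f z = 0" by simp
    with eq have "(\<Sum>x\<in>pverts G. \<Sum>y\<in>nbrs G x. (f x - f y)\<^sup>2) = 0" by simp
    then have step: "f x = f y" if "x \<in> pverts G" "y \<in> nbrs G x" for x y
      using that by (simp add: sum_nonneg_eq_0_iff sum_nonneg pair_finite_verts)
    have "reachable (with_proj G) z y" using sc z y by (auto simp: strongly_connected_def)
    then have "f y = f z"
    proof (induction rule: reachable_induct)
      case (step u v)
      then show ?case using \<open>\<And>y x. \<lbrakk>x \<in> pverts G; y \<in> nbrs G x\<rbrakk> \<Longrightarrow> f x = f y\<close>[of u v]
        by (auto simp: nbrs_def dest: in_arcsD1)
    qed simp
    with fz show ?thesis by simp
  qed
  have "\<exists>f. \<forall>x\<in>pverts G. laplacian G f x = of_bool (x = i) - of_bool (x = z)"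
    if i: "i \<in> pverts G" for i
  proof -
    obtain f where "\<And>x. x \<in> pverts G \<Longrightarrow> (\<Sum>y\<in>pverts G. A x y * f y) = of_bool (x = i)"
    proof (rule linear_system_solvable[of "pverts G" A "\<lambda>x. of_bool (x = i)"])
      show "f y = 0"
        if "\<And>x. x \<in> pverts G \<Longrightarrow> (\<Sum>y\<in>pverts G. A x y * f y) = 0" "y \<in> pverts G" for f y
        using that by (rule ker)
      show ?thesis if "\<And>x. x \<in> pverts G \<Longrightarrow> (\<Sum>y\<in>pverts G. A x y * f y) = of_bool (x = i)" for f
        using that by (rule \<open>\<And>f. (\<And>x. x \<in> pverts G \<Longrightarrow> (\<Sum>y\<in>pverts G. A x y * f y) = of_bool (x = i)) \<Longrightarrow> thesis\<close>)
    qed (rule pair_finite_verts)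
    then have f: "laplacian G f x = of_bool (x = i) - of_bool (x = z) * f z"
      if "x \<in> pverts G" for x
      using A[OF that, of f] that by (simp add: algebra_simps)
    have "0 = (\<Sum>x\<in>pverts G. laplacian G f x)" by (simp add: sum_laplacian)
    also have "\<dots> = (\<Sum>x\<in>pverts G. (if x = i then 1 else 0)) - (\<Sum>x\<in>pverts G. (if x = z then f z else 0))"
      unfolding sum_subtractf[symmetric] by (intro sum.cong) (auto simp: f)
    also have "\<dots> = 1 - f z" using i z by (simp add: pair_finite_verts)
    finally have "f z = 1" by simp
    with f show ?thesis by (intro exI[of _ f]) simp
  qed
  then obtain g where "\<forall>i\<in>pverts G. \<forall>x\<in>pverts G. laplacian G (g i) x = of_bool (x = i) - of_bool (x = z)"
    by metis
  with z that show thesis by (auto simp: green_function_def)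
qed

text \<open>
  The diagonal pairs may be included in the sum because their resistance expression vanishes. The
  expression then expands into two equal diagonal sums and two equal double sums.
\<close>

lemma Kf_mult_green:
  assumes green: "green_function G z g"
  shows "Kf_mult G =
    (\<Sum>x\<in>pverts G. real (vertex_degree G x)) * (\<Sum>x\<in>pverts G. real (vertex_degree G x) * g x x)
    - (\<Sum>x\<in>pverts G. real (vertex_degree G x) * (\<Sum>y\<in>pverts G. real (vertex_degree G y) * g x y))"
proof -
  let ?V = "pverts G" and ?d = "\<lambda>x. real (vertex_degree G x)"
  have "(\<Sum>i\<in>?V. \<Sum>j\<in>?V - {i}. ?d i * ?d j * resistance G i j)
      = (\<Sum>i\<in>?V. \<Sum>j\<in>?V. ?d i * ?d j * (g i i - g i j - g j i + g j j))"
    by (intro sum.cong refl sum.mono_neutral_cong_left)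
      (auto simp: resistance_green[OF green] pair_finite_verts)
  also have "\<dots> = (\<Sum>i\<in>?V. \<Sum>j\<in>?V. ?d j * (?d i * g i i)) - (\<Sum>i\<in>?V. \<Sum>j\<in>?V. ?d i * (?d j * g i j))
      - (\<Sum>i\<in>?V. \<Sum>j\<in>?V. ?d j * (?d i * g j i)) + (\<Sum>i\<in>?V. \<Sum>j\<in>?V. ?d i * (?d j * g j j))"
    by (simp add: sum.distrib[symmetric] sum_subtractf[symmetric] algebra_simps)
  also have "(\<Sum>i\<in>?V. \<Sum>j\<in>?V. ?d j * (?d i * g j i)) = (\<Sum>i\<in>?V. \<Sum>j\<in>?V. ?d i * (?d j * g i j))"
    by (rule sum.swap)
  also have "(\<Sum>i\<in>?V. \<Sum>j\<in>?V. ?d j * (?d i * g i i)) = (\<Sum>i\<in>?V. \<Sum>j\<in>?V. ?d i * (?d j * g j j))"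
    by (rule sum.swap)
  also have "\<dots> = (\<Sum>i\<in>?V. ?d i) * (\<Sum>j\<in>?V. ?d j * g j j)"
    by (simp add: sum_product)
  finally show ?thesis
    unfolding Kf_mult_def sum_distrib_left[symmetric] by linarith
qed

text \<open>
  This is Foster's theorem in terms of a Green function: twice the sum, symmetrised over both
  orientations of an edge, is the sum of the resistances over the arcs. The inner sum is the Laplacian
  of \<open>g x\<close> at its own source \<open>x\<close>, which is $1$ except at the ground vertex, where it is $0$.
\<close>

lemma foster_theorem:
  assumes green: "green_function G z g"
  shows "(\<Sum>x\<in>pverts G. \<Sum>y\<in>nbrs G x. g x x - g x y) = real (card (pverts G)) - 1"
proof -
  have "(\<Sum>x\<in>pverts G. \<Sum>y\<in>nbrs G x. g x x - g x y) = (\<Sum>x\<in>pverts G. 1 - (if x = z then 1 else 0))"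
    using green by (intro sum.cong) (auto simp: green_function_def laplacian_def)
  also have "\<dots> = real (card (pverts G)) - 1"
    using green by (simp add: sum_subtractf green_function_def pair_finite_verts)
  finally show ?thesis .
qed

end

section \<open>Sums over undirected edges\<close>

definition end_mean :: "('a \<Rightarrow> real) \<Rightarrow> 'a uprod \<Rightarrow> real" where
  "end_mean f e = (\<Sum>a\<in>set_uprod e. f a) / 2"

lemma end_mean_swap:
  "end_mean (\<lambda>a. end_mean (g a) e') e = end_mean (\<lambda>b. end_mean (\<lambda>a. g a b) e) e'"
  unfolding end_mean_def sum_divide_distrib by (subst sum.swap) simp

lemma end_mean_scale: "end_mean (\<lambda>a. c * f a) e = c * end_mean f e"
  by (simp add: end_mean_def sum_distrib_left)

lemma end_mean_Upair: "a \<noteq> b \<Longrightarrow> end_mean f (Upair a b) = (f a + f b) / 2"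
  by (simp add: end_mean_def)

context pair_graph
begin

lemma uedges_iff: "e \<in> uedges G \<longleftrightarrow> (\<exists>a b. e = Upair a b \<and> b \<in> nbrs G a)"
  by (force simp: uedges_def nbrs_def)

lemma Upair_in_uedges: "Upair a b \<in> uedges G \<longleftrightarrow> b \<in> nbrs G a"
  using nbrs_sym by (auto simp: uedges_iff)

lemma uedgeE:
  assumes "e \<in> uedges G"
  obtains a b where "e = Upair a b" "b \<in> nbrs G a" "a \<noteq> b" "a \<in> pverts G" "b \<in> pverts G"
proof -
  from assms obtain a b where ab: "e = Upair a b" "b \<in> nbrs G a" by (auto simp: uedges_iff)
  moreover from ab have "a \<noteq> b" using not_in_own_nbrs by auto
  ultimately show thesis using nbrs_in_verts by (intro that)
qed

lemma edge_ends_in_verts: "e \<in> uedges G \<Longrightarrow> a \<in> set_uprod e \<Longrightarrow> a \<in> pverts G"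
  by (auto elim!: uedgeE)

lemma finite_uedges [simp]: "finite (uedges G)"
  by (simp add: uedges_def pair_finite_arcs)

text \<open>
  Double counting of incidences: for a fixed vertex \<open>a\<close> the edges at \<open>a\<close> correspond to the
  neighbours of \<open>a\<close>.
\<close>

lemma sum_edge_ends:
  fixes F :: "'a uprod \<Rightarrow> 'a \<Rightarrow> real"
  shows "(\<Sum>e\<in>uedges G. \<Sum>a\<in>set_uprod e. F e a) = (\<Sum>a\<in>pverts G. \<Sum>b\<in>nbrs G a. F (Upair a b) a)"
proof -
  have "(\<Sum>e\<in>uedges G. \<Sum>a\<in>set_uprod e. F e a)
      = (\<Sum>e\<in>uedges G. \<Sum>a | a \<in> pverts G \<and> a \<in> set_uprod e. F e a)"
    by (intro sum.cong refl) (auto elim!: uedgeE)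
  also have "\<dots> = (\<Sum>a\<in>pverts G. \<Sum>e | e \<in> uedges G \<and> a \<in> set_uprod e. F e a)"
    by (rule sum.swap_restrict) (simp_all add: pair_finite_verts)
  also have "\<dots> = (\<Sum>a\<in>pverts G. \<Sum>b\<in>nbrs G a. F (Upair a b) a)"
  proof (intro sum.cong refl)
    fix a
    have "Upair u v \<in> Upair a ` nbrs G a" if "v \<in> nbrs G u" "a = u \<or> a = v" for u v
      using that nbrs_sym[of u v] rev_image_eqI[of v "nbrs G a" "Upair u v" "Upair a"]
        rev_image_eqI[of u "nbrs G a" "Upair u v" "Upair a"] by auto
    then have "{e. e \<in> uedges G \<and> a \<in> set_uprod e} = Upair a ` nbrs G a"
      by (auto simp: uedges_iff)
    moreover have "inj_on (Upair a) (nbrs G a)" by (auto simp: inj_on_def)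
    ultimately show "(\<Sum>e | e \<in> uedges G \<and> a \<in> set_uprod e. F e a) = (\<Sum>b\<in>nbrs G a. F (Upair a b) a)"
      by (simp add: sum.reindex)
  qed
  finally show ?thesis .
qed

lemma sum_end_mean:
  "(\<Sum>e\<in>uedges G. end_mean f e) = (\<Sum>a\<in>pverts G. real (vertex_degree G a) * f a) / 2"
  by (simp add: end_mean_def sum_divide_distrib[symmetric] sum_edge_ends[of "\<lambda>e. f"]
      vertex_degree_nbrs)

lemma handshake: "(\<Sum>a\<in>pverts G. real (vertex_degree G a)) = 2 * real (card (uedges G))"
proof -
  have "(\<Sum>e\<in>uedges G. end_mean (\<lambda>_. 1) e) = (\<Sum>e\<in>uedges G. 1)"
    by (intro sum.cong refl) (auto elim!: uedgeE simp: end_mean_Upair)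
  then show ?thesis using sum_end_mean[of "\<lambda>_. 1"] by simp
qed

end

section \<open>The Green function of the blow-up\<close>

text \<open>
  In the absence of injected current a new vertex takes the mean of the potentials at the two ends of
  its edge, so this is the extension of a potential from the old graph to the blow-up. Vertices of the
  form \<open>Base a\<close> never belong to a blow-up; they get a default value.
\<close>

definition mean_extension :: "('a clvertex \<Rightarrow> real) \<Rightarrow> 'a clvertex \<Rightarrow> real" where
  "mean_extension f x = (case x of Base _ \<Rightarrow> 0 | Old a \<Rightarrow> f a | New e k \<Rightarrow> end_mean f e)"

lemma mean_extension_simps [simp]: "mean_extension f (Old a) = f a" "mean_extension f (New e k) = end_mean f e"
  by (simp_all add: mean_extension_def)

text \<open>
  The response inside one clique to a unit current injected at the new vertex \<open>New e k\<close> and drawn off,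
  one half each, at the ends of \<open>e\<close>: with \<open>c j\<close> the deviation of the potential of \<open>New e j\<close> from the
  mean over the ends, the current balance is \<open>n * c j - (\<Sum>i<n - 2. c i) = of_bool (j = k)\<close>. Summing
  over \<open>j\<close> gives \<open>(\<Sum>i<n - 2. c i) = 1 / 2\<close>, whence the entries below.
\<close>

fun clique_term :: "nat \<Rightarrow> 'a clvertex \<Rightarrow> 'a clvertex \<Rightarrow> real" where
  "clique_term n (New e k) (New e' k') = of_bool (e = e') * (1 / (2 * real n) + of_bool (k = k') / real n)"
| "clique_term n _ _ = 0"

text \<open>
  Extending in the first argument distributes the current injected at a new vertex evenly over the two
  ends of its edge.
\<close>

definition blowup_green ::
    "nat \<Rightarrow> ('a clvertex \<Rightarrow> 'a clvertex \<Rightarrow> real) \<Rightarrow> 'a clvertex \<Rightarrow> 'a clvertex \<Rightarrow> real" where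
  "blowup_green n g x y = 2 / real n * mean_extension (\<lambda>a. mean_extension (g a) y) x + clique_term n x y"

locale clique_blowup = pair_graph G for G :: "'a clvertex pair_pre_digraph" +
  fixes n :: nat
  assumes n: "n \<ge> 3"
begin

lemma pverts_CL: "pverts (CL n G) = Old ` pverts G \<union> (\<Union>e\<in>uedges G. New e ` {..<n - 2})"
  by (simp add: CL_def new_verts_def)

text \<open>
  The clique on an edge joins its two ends once more, so the arcs between old vertices arise in two
  ways but are counted once.
\<close>

lemma nbrs_CL_Old:
  "nbrs (CL n G) (Old a) = Old ` nbrs G a \<union> (\<Union>b\<in>nbrs G a. New (Upair a b) ` {..<n - 2})"
proof -
  have 1: "y \<in> Old ` nbrs G a \<union> (\<Union>b\<in>nbrs G a. New (Upair a b) ` {..<n - 2})"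
    if "(Old a, y) \<in> parcs (CL n G)" for y
    using that nbrs_sym
    by (auto simp: CL_def new_verts_def uedges_iff) (auto simp: nbrs_def)
  have 2: "(Old a, Old b) \<in> parcs (CL n G)" if "b \<in> nbrs G a" for b
    using that by (force simp: CL_def nbrs_def)
  have 3: "(Old a, New (Upair a b) k) \<in> parcs (CL n G)" if "b \<in> nbrs G a" "k < n - 2" for b k
    using that by (auto simp: CL_def new_verts_def Upair_in_uedges intro!: bexI[of _ "Upair a b"])
  show ?thesis
    using 1 2 3 by (auto simp: nbrs_def[of "CL n G"])
qed

lemma nbrs_CL_New:
  assumes "e \<in> uedges G" "k < n - 2"
  shows "nbrs (CL n G) (New e k) = (Old ` set_uprod e \<union> New e ` {..<n - 2}) - {New e k}"
  using assms by (auto simp: nbrs_def CL_def new_verts_def)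

lemma pair_graph_CL: "pair_graph (CL n G)"
proof
  show "fst e \<in> pverts (CL n G)" if "e \<in> parcs (CL n G)" for e
    using that by (auto simp: CL_def dest: in_arcsD1 edge_ends_in_verts)
  show "snd e \<in> pverts (CL n G)" if "e \<in> parcs (CL n G)" for e
    using that by (auto simp: CL_def dest: in_arcsD2 edge_ends_in_verts)
  show "finite (pverts (CL n G))"
    by (simp add: pverts_CL pair_finite_verts)
  have "parcs (CL n G) \<subseteq> pverts (CL n G) \<times> pverts (CL n G)"
    by (auto simp: CL_def dest: in_arcsD1 in_arcsD2 edge_ends_in_verts)
  then show "finite (parcs (CL n G))"
    by (rule finite_subset) (simp add: pverts_CL pair_finite_verts)
  show "symmetric (with_proj (CL n G))"
    using pair_sym_arcs
    by (force simp: symmetric_def sym_def CL_def)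
  show "fst e \<noteq> snd e" if "e \<in> parcs (CL n G)" for e
    using that pair_no_loops by (fastforce simp: CL_def)
qed

lemma sum_pverts_CL:
  fixes F :: "'a clvertex \<Rightarrow> real"
  shows "(\<Sum>x\<in>pverts (CL n G). F x)
    = (\<Sum>a\<in>pverts G. F (Old a)) + (\<Sum>e\<in>uedges G. \<Sum>k<n - 2. F (New e k))"
proof -
  have "(\<Sum>x\<in>pverts (CL n G). F x)
      = (\<Sum>x\<in>Old ` pverts G. F x) + (\<Sum>x\<in>(\<Union>e\<in>uedges G. New e ` {..<n - 2}). F x)"
    unfolding pverts_CL by (rule sum.union_disjoint) (auto simp: pair_finite_verts)
  also have "(\<Sum>x\<in>(\<Union>e\<in>uedges G. New e ` {..<n - 2}). F x) = (\<Sum>e\<in>uedges G. \<Sum>x\<in>New e ` {..<n - 2}. F x)"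
    by (rule sum.UNION_disjoint) auto
  finally show ?thesis by (simp add: sum.reindex inj_on_def)
qed

lemma sum_nbrs_CL_Old:
  fixes F :: "'a clvertex \<Rightarrow> real"
  shows "(\<Sum>x\<in>nbrs (CL n G) (Old a). F x)
    = (\<Sum>b\<in>nbrs G a. F (Old b)) + (\<Sum>b\<in>nbrs G a. \<Sum>k<n - 2. F (New (Upair a b) k))"
proof -
  have "(\<Sum>x\<in>nbrs (CL n G) (Old a). F x)
      = (\<Sum>x\<in>Old ` nbrs G a. F x) + (\<Sum>x\<in>(\<Union>b\<in>nbrs G a. New (Upair a b) ` {..<n - 2}). F x)"
    unfolding nbrs_CL_Old by (rule sum.union_disjoint) auto
  also have "(\<Sum>x\<in>(\<Union>b\<in>nbrs G a. New (Upair a b) ` {..<n - 2}). F x)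
      = (\<Sum>b\<in>nbrs G a. \<Sum>x\<in>New (Upair a b) ` {..<n - 2}. F x)"
    by (rule sum.UNION_disjoint) auto
  finally show ?thesis by (simp add: sum.reindex inj_on_def)
qed

lemma sum_nbrs_CL_New:
  fixes F :: "'a clvertex \<Rightarrow> real"
  assumes "e \<in> uedges G" "k < n - 2"
  shows "(\<Sum>x\<in>nbrs (CL n G) (New e k). F x)
    = (\<Sum>a\<in>set_uprod e. F (Old a)) + (\<Sum>j<n - 2. F (New e j)) - F (New e k)"
proof -
  have "(\<Sum>x\<in>nbrs (CL n G) (New e k). F x)
      = (\<Sum>x\<in>Old ` set_uprod e \<union> New e ` {..<n - 2}. F x) - F (New e k)"
    using assms(2) by (simp add: nbrs_CL_New[OF assms] sum_diff1)
  also have "(\<Sum>x\<in>Old ` set_uprod e \<union> New e ` {..<n - 2}. F x)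
      = (\<Sum>x\<in>Old ` set_uprod e. F x) + (\<Sum>x\<in>New e ` {..<n - 2}. F x)"
    by (rule sum.union_disjoint) auto
  finally show ?thesis by (simp add: sum.reindex inj_on_def)
qed

lemma real_n_diff: "real (n - 2) = real n - 2"
  using n by (simp add: of_nat_diff)

lemma degree_CL_Old: "real (vertex_degree (CL n G) (Old a)) = (real n - 1) * real (vertex_degree G a)"
  using sum_nbrs_CL_Old[of "\<lambda>_. 1" a]
  by (simp add: vertex_degree_nbrs real_n_diff algebra_simps)

lemma degree_CL_New:
  assumes "e \<in> uedges G" "k < n - 2"
  shows "real (vertex_degree (CL n G) (New e k)) = real n - 1"
proof -
  have "card (set_uprod e) = 2" using assms(1) by (auto elim!: uedgeE)
  then show ?thesis
    using sum_nbrs_CL_New[OF assms, of "\<lambda>_. 1"] by (simp add: vertex_degree_nbrs real_n_diff)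
qed

lemma sum_degree_CL:
  "(\<Sum>x\<in>pverts (CL n G). real (vertex_degree (CL n G) x) * F x)
    = (real n - 1) * ((\<Sum>a\<in>pverts G. real (vertex_degree G a) * F (Old a))
        + (\<Sum>e\<in>uedges G. \<Sum>k<n - 2. F (New e k)))"
  by (simp add: sum_pverts_CL degree_CL_Old degree_CL_New sum_distrib_left distrib_left mult.assoc)

text \<open>
  Both the old vertices and the means over the edges carry degree weights proportional to the old
  degrees, hence the stationary distribution of the blow-up averages to that of the old graph.
\<close>

lemma sum_degree_mean_extension:
  "(\<Sum>x\<in>pverts (CL n G). real (vertex_degree (CL n G) x) * mean_extension f x)
    = real n * (real n - 1) / 2 * (\<Sum>a\<in>pverts G. real (vertex_degree G a) * f a)"
proof -
  have new: "(\<Sum>e\<in>uedges G. \<Sum>k<n - 2. end_mean f e)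
      = (real n - 2) * ((\<Sum>a\<in>pverts G. real (vertex_degree G a) * f a) / 2)"
    by (simp add: real_n_diff sum_distrib_left[symmetric] sum_end_mean)
  show ?thesis
    unfolding sum_degree_CL mean_extension_simps new by (simp add: field_simps)
qed

lemma card_pverts_CL: "real (card (pverts (CL n G))) = real (card (pverts G)) + (real n - 2) * real (card (uedges G))"
  using sum_pverts_CL[of "\<lambda>_. 1"] by (simp add: real_n_diff)

lemma card_uedges_CL: "real (card (uedges (CL n G))) = real n * (real n - 1) / 2 * real (card (uedges G))"
  using pair_graph.handshake[OF pair_graph_CL] sum_degree_CL[of "\<lambda>_. 1"]
  by (simp add: handshake real_n_diff field_simps)

text \<open>
  Each edge at \<open>a\<close> contributes the old potential difference once directly and \<open>n - 2\<close> times half through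
  the new vertices, which makes \<open>n / 2\<close>; the rest is the current returned by new vertices deviating from
  the edge mean.
\<close>

lemma laplacian_CL_Old:
  "laplacian (CL n G) F (Old a) = real n / 2 * laplacian G (\<lambda>b. F (Old b)) a
    - (\<Sum>b\<in>nbrs G a. \<Sum>k<n - 2. F (New (Upair a b) k) - end_mean (\<lambda>b. F (Old b)) (Upair a b))"
proof -
  let ?f = "\<lambda>b. F (Old b)"
  have "laplacian (CL n G) F (Old a)
      = (\<Sum>b\<in>nbrs G a. (?f a - ?f b) + (\<Sum>k<n - 2. ?f a - F (New (Upair a b) k)))"
    by (simp add: laplacian_def sum_nbrs_CL_Old sum.distrib)
  also have "\<dots> = (\<Sum>b\<in>nbrs G a. real n / 2 * (?f a - ?f b)
      - (\<Sum>k<n - 2. F (New (Upair a b) k) - end_mean ?f (Upair a b)))"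
  proof (intro sum.cong refl)
    fix b assume "b \<in> nbrs G a"
    then have "a \<noteq> b" using not_in_own_nbrs by auto
    then show "(?f a - ?f b) + (\<Sum>k<n - 2. ?f a - F (New (Upair a b) k))
        = real n / 2 * (?f a - ?f b) - (\<Sum>k<n - 2. F (New (Upair a b) k) - end_mean ?f (Upair a b))"
      unfolding sum_subtractf sum_constant
      by (simp add: end_mean_Upair real_n_diff field_simps)
  qed
  also have "\<dots> = (\<Sum>b\<in>nbrs G a. real n / 2 * (?f a - ?f b))
      - (\<Sum>b\<in>nbrs G a. \<Sum>k<n - 2. F (New (Upair a b) k) - end_mean ?f (Upair a b))"
    by (rule sum_subtractf)
  also have "(\<Sum>b\<in>nbrs G a. real n / 2 * (?f a - ?f b)) = real n / 2 * laplacian G ?f a"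
    unfolding laplacian_def by (rule sum_distrib_left[symmetric])
  finally show ?thesis .
qed

text \<open>
  The means cancel: only the deviations \<open>c\<close> from the edge mean drive a current at a new vertex.
\<close>

lemma laplacian_CL_New:
  assumes e: "e \<in> uedges G" and k: "k < n - 2"
    and F: "\<And>j. j < n - 2 \<Longrightarrow> F (New e j) = end_mean (\<lambda>b. F (Old b)) e + c j"
  shows "laplacian (CL n G) F (New e k) = real n * c k - (\<Sum>j<n - 2. c j)"
proof -
  obtain a b where ab: "e = Upair a b" "a \<noteq> b" using e by (elim uedgeE)
  have "laplacian (CL n G) F (New e k)
      = (\<Sum>a\<in>set_uprod e. F (New e k) - F (Old a)) + (\<Sum>j<n - 2. F (New e k) - F (New e j))"
    by (simp add: laplacian_def sum_nbrs_CL_New[OF e k])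
  also have "(\<Sum>a\<in>set_uprod e. F (New e k) - F (Old a)) = 2 * c k"
    using ab F[OF k] by (simp add: end_mean_Upair)
  also have "(\<Sum>j<n - 2. F (New e k) - F (New e j)) = (\<Sum>j<n - 2. c k - c j)"
    using F k by (intro sum.cong) auto
  also have "\<dots> = (real n - 2) * c k - (\<Sum>j<n - 2. c j)"
    by (simp add: sum_subtractf real_n_diff)
  finally show ?thesis by (simp add: algebra_simps)
qed

lemma sum_clique_term:
  assumes "k < n - 2"
  shows "(\<Sum>j<n - 2. 1 / (2 * real n) + of_bool (k = j) / real n) = 1 / 2"
proof -
  have "(\<Sum>j<n - 2. of_bool (k = j) / real n) = (\<Sum>j<n - 2. if k = j then 1 / real n else 0)"
    by (intro sum.cong) auto
  also have "\<dots> = 1 / real n" using assms by simp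
  finally have diagonal: "(\<Sum>j<n - 2. of_bool (k = j) / real n) = 1 / real n" .
  show ?thesis
    unfolding sum.distrib diagonal using n by (simp add: real_n_diff field_simps)
qed

lemma blowup_green_New:
  "blowup_green n g x (New e k) = end_mean (\<lambda>b. blowup_green n g x (Old b)) e + clique_term n x (New e k)"
proof (cases x)
  case (New e' j)
  then show ?thesis
    unfolding New blowup_green_def mean_extension_simps clique_term.simps add_0_right end_mean_scale
      end_mean_swap[of g e e'] by simp
next
  case (Old i)
  show ?thesis
    unfolding Old blowup_green_def mean_extension_simps clique_term.simps add_0_right end_mean_scale by simp
qed (simp add: blowup_green_def mean_extension_def end_mean_def)

text \<open>
  At an old vertex the factors \<open>n / 2\<close> and \<open>2 / n\<close> cancel, and a source at a new vertex of \<open>e\<close> needs the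
  half unit that its clique term feeds into each end of \<open>e\<close>. At a new vertex only the clique term
  contributes.
\<close>

lemma green_CL:
  assumes green: "green_function G z g"
  shows "green_function (CL n G) (Old z) (blowup_green n g)"
  unfolding green_function_def
proof (intro conjI ballI)
  let ?h = "blowup_green n g"
  have z: "z \<in> pverts G"
    and g: "\<And>i x. \<lbrakk>i \<in> pverts G; x \<in> pverts G\<rbrakk>
      \<Longrightarrow> laplacian G (g i) x = of_bool (x = i) - of_bool (x = z)"
    using green by (auto simp: green_function_def)
  show "Old z \<in> pverts (CL n G)" using z by (simp add: pverts_CL)
  fix x y assume x: "x \<in> pverts (CL n G)" and y: "y \<in> pverts (CL n G)"
  have n0: "real n \<noteq> 0" using n by simp
  show "laplacian (CL n G) (?h x) y = of_bool (y = x) - of_bool (y = Old z)"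
  proof (cases y)
    case y': (Old a)
    with y have a: "a \<in> pverts G" by (auto simp: pverts_CL)
    have lap: "laplacian (CL n G) (?h x) (Old a) = real n / 2 * laplacian G (\<lambda>b. ?h x (Old b)) a
        - (\<Sum>b\<in>nbrs G a. \<Sum>k<n - 2. clique_term n x (New (Upair a b) k))"
      by (simp add: laplacian_CL_Old blowup_green_New)
    show ?thesis
    proof (cases x)
      case (Old i)
      with x have "i \<in> pverts G" by (auto simp: pverts_CL)
      then show ?thesis
        using y' Old lap n0 g a laplacian_linear[of G "2 / real n" "g i" 0 "g i" a]
        by (simp add: blowup_green_def)
    next
      case (New e j)
      with x have e: "e \<in> uedges G" "j < n - 2" by (auto simp: pverts_CL)
      then obtain u v where uv: "e = Upair u v" "v \<in> nbrs G u" "u \<noteq> v" "u \<in> pverts G" "v \<in> pverts G"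
        by (elim uedgeE)
      have "(\<lambda>b. ?h x (Old b)) = (\<lambda>b. 1 / real n * g u b + 1 / real n * g v b)"
        by (rule ext) (simp add: New uv(1) blowup_green_def end_mean_Upair[OF uv(3)] add_divide_distrib distrib_left)
      then have "laplacian G (\<lambda>b. ?h x (Old b)) a
          = 1 / real n * (of_bool (a = u) - of_bool (a = z)) + 1 / real n * (of_bool (a = v) - of_bool (a = z))"
        by (simp only: laplacian_linear g[OF uv(4) a] g[OF uv(5) a])
      then have inflow: "real n / 2 * laplacian G (\<lambda>b. ?h x (Old b)) a
          = (of_bool (a = u) + of_bool (a = v)) / 2 - of_bool (a = z)"
        using n0 by (simp only:) (simp add: field_simps)
      have "(\<Sum>b\<in>nbrs G a. \<Sum>k<n - 2. clique_term n x (New (Upair a b) k))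
          = (\<Sum>b\<in>nbrs G a. of_bool (e = Upair a b) * (1 / 2))"
        unfolding New by (simp only: clique_term.simps sum_distrib_left[symmetric] sum_clique_term[OF e(2)])
      also have "\<dots> = (\<Sum>b\<in>nbrs G a. (if b = v then of_bool (a = u) / 2 else 0))
          + (\<Sum>b\<in>nbrs G a. (if b = u then of_bool (a = v) / 2 else 0))"
        unfolding sum.distrib[symmetric] using uv(1,3) by (intro sum.cong) auto
      also have "\<dots> = (of_bool (a = u) + of_bool (a = v)) / 2"
        using uv(2,3) nbrs_sym[of u v] by auto
      finally have "laplacian (CL n G) (?h x) (Old a) = - of_bool (a = z)"
        using lap inflow by linarith
      then show ?thesis
        by (simp add: y' New)
    qed (use x in \<open>auto simp: pverts_CL\<close>)
  next
    case y': (New e k)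
    with y have e: "e \<in> uedges G" "k < n - 2" by (auto simp: pverts_CL)
    have lap: "laplacian (CL n G) (?h x) (New e k)
        = real n * clique_term n x (New e k) - (\<Sum>j<n - 2. clique_term n x (New e j))"
      by (rule laplacian_CL_New[OF e]) (rule blowup_green_New)
    show ?thesis
    proof (cases x)
      case (New e' j)
      with x have j: "j < n - 2" by (auto simp: pverts_CL)
      have "(\<Sum>i<n - 2. clique_term n x (New e i)) = of_bool (e' = e) * (1 / 2)"
        unfolding New by (simp only: clique_term.simps sum_distrib_left[symmetric] sum_clique_term[OF j])
      then show ?thesis
        using lap y' New n0 by (auto simp: field_simps)
    qed (use x lap y' in \<open>auto simp: pverts_CL\<close>)
  qed (use x y in \<open>auto simp: pverts_CL\<close>)
qed

text \<open>
  The formula for the index via a Green function is evaluated for \<open>blowup_green\<close>. The term linear in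
  \<open>E\<close> that remains from the clique terms cancels the one coming from the \<open>- 1\<close> in Foster's theorem.
\<close>

lemma Kf_mult_CL:
  assumes green: "green_function G z g"
  shows "Kf_mult (CL n G) = real n * (real n - 1)\<^sup>2 / 2 * Kf_mult G
    - (real n - 1)\<^sup>2 * (real n - 2) / 2 * real (card (uedges G)) * real (card (pverts G))
    + 3 * (real n - 1)\<^sup>2 * (real n - 2) / 2 * (real (card (uedges G)))\<^sup>2"
proof -
  let ?h = "blowup_green n g" and ?H = "CL n G"
  let ?d = "\<lambda>a. real (vertex_degree G a)" and ?D = "\<lambda>x. real (vertex_degree (CL n G) x)"
  let ?q = "real n * (real n - 1) / 2"
  define E where "E = real (card (uedges G))"
  define N where "N = real (card (pverts G))"
  define T where "T = (\<Sum>a\<in>pverts G. ?d a * g a a)"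
  define S where "S = (\<Sum>a\<in>pverts G. ?d a * (\<Sum>b\<in>pverts G. ?d b * g a b))"
  have n0: "real n \<noteq> 0" using n by simp
  have KfG: "Kf_mult G = 2 * E * T - S"
    by (simp add: Kf_mult_green[OF green] handshake E_def T_def S_def)

  \<comment> \<open>Foster's theorem takes care of the entries \<open>g a b\<close> with \<open>ab\<close> an edge.\<close>
  have diag: "(\<Sum>e\<in>uedges G. end_mean (\<lambda>a. end_mean (g a) e) e) = T / 2 - (N - 1) / 4"
  proof -
    have "(\<Sum>e\<in>uedges G. end_mean (\<lambda>a. end_mean (g a) e) e)
        = (\<Sum>e\<in>uedges G. \<Sum>a\<in>set_uprod e. end_mean (g a) e) / 2"
      by (simp add: end_mean_def[of "\<lambda>a. end_mean (g a) _"] sum_divide_distrib)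
    also have "(\<Sum>e\<in>uedges G. \<Sum>a\<in>set_uprod e. end_mean (g a) e)
        = (\<Sum>a\<in>pverts G. \<Sum>b\<in>nbrs G a. end_mean (g a) (Upair a b))"
      by (rule sum_edge_ends)
    also have "\<dots> = (\<Sum>a\<in>pverts G. \<Sum>b\<in>nbrs G a. g a a - (g a a - g a b) / 2)"
    proof (intro sum.cong refl)
      fix a b assume "b \<in> nbrs G a"
      then have "a \<noteq> b" using not_in_own_nbrs by auto
      then show "end_mean (g a) (Upair a b) = g a a - (g a a - g a b) / 2"
        by (simp add: end_mean_Upair field_simps)
    qed
    also have "\<dots> = T - (N - 1) / 2"
      using foster_theorem[OF green]
      by (simp add: sum_subtractf sum_divide_distrib[symmetric] T_def N_def vertex_degree_nbrs)
    finally show ?thesis by (simp add: field_simps)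
  qed

  have trace: "(\<Sum>x\<in>pverts ?H. ?D x * ?h x x)
      = (real n - 1) * (T - (real n - 2) * (N - 1) / (2 * real n) + 3 * (real n - 2) * E / (2 * real n))"
  proof -
    have "(\<Sum>x\<in>pverts ?H. ?D x * ?h x x) = (real n - 1) * ((\<Sum>a\<in>pverts G. ?d a * (2 / real n * g a a))
        + (\<Sum>e\<in>uedges G. \<Sum>k<n - 2. 2 / real n * end_mean (\<lambda>a. end_mean (g a) e) e + 3 / (2 * real n)))"
      by (simp add: sum_degree_CL blowup_green_def)
    also have "(\<Sum>a\<in>pverts G. ?d a * (2 / real n * g a a)) = 2 / real n * T"
      by (simp add: T_def sum_distrib_left mult_ac)
    also have "(\<Sum>e\<in>uedges G. \<Sum>k<n - 2. 2 / real n * end_mean (\<lambda>a. end_mean (g a) e) e + 3 / (2 * real n))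
        = (real n - 2) * (2 / real n * (T / 2 - (N - 1) / 4) + 3 / (2 * real n) * E)"
    proof -
      have "(\<Sum>e\<in>uedges G. \<Sum>k<n - 2. 2 / real n * end_mean (\<lambda>a. end_mean (g a) e) e + 3 / (2 * real n))
          = (\<Sum>e\<in>uedges G. (real n - 2) * (2 / real n) * end_mean (\<lambda>a. end_mean (g a) e) e
              + (real n - 2) * 3 / (2 * real n))"
        by (intro sum.cong refl) (simp add: real_n_diff algebra_simps)
      also have "\<dots> = (real n - 2) * (2 / real n) * (T / 2 - (N - 1) / 4) + E * ((real n - 2) * 3 / (2 * real n))"
        unfolding sum.distrib sum_distrib_left[symmetric] diag by (simp add: E_def)
      also have "(m - 2) * (2 / m) * P + E * ((m - 2) * 3 / (2 * m)) = (m - 2) * (2 / m * P + 3 / (2 * m) * E)"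
        for m P by (simp add: algebra_simps)
      finally show ?thesis .
    qed
    also have "2 / m * T + (m - 2) * (2 / m * (T / 2 - (N - 1) / 4) + 3 / (2 * m) * E)
        = T - (m - 2) * (N - 1) / (2 * m) + 3 * (m - 2) * E / (2 * m)" if "m \<noteq> 0" for m
      using that by (simp add: field_simps)
    note this[OF n0]
    finally show ?thesis .
  qed

  \<comment> \<open>In the double sum both extensions collapse by \<open>sum_degree_mean_extension\<close>, one factor \<open>?q\<close> each.\<close>
  have total: "(\<Sum>x\<in>pverts ?H. ?D x * (\<Sum>y\<in>pverts ?H. ?D y * ?h x y))
      = 2 / real n * ?q\<^sup>2 * S + (real n - 1)\<^sup>2 * (real n - 2) / 2 * E"
  proof -
    have split: "(\<Sum>x\<in>pverts ?H. ?D x * (\<Sum>y\<in>pverts ?H. ?D y * ?h x y))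
        = 2 / real n * (\<Sum>x\<in>pverts ?H. ?D x * (\<Sum>y\<in>pverts ?H. ?D y * mean_extension (\<lambda>a. mean_extension (g a) y) x))
          + (\<Sum>x\<in>pverts ?H. ?D x * (\<Sum>y\<in>pverts ?H. ?D y * clique_term n x y))"
      by (simp add: blowup_green_def distrib_left sum.distrib sum_distrib_left mult_ac)
    have "(\<Sum>x\<in>pverts ?H. ?D x * (\<Sum>y\<in>pverts ?H. ?D y * mean_extension (\<lambda>a. mean_extension (g a) y) x))
        = (\<Sum>y\<in>pverts ?H. ?D y * (\<Sum>x\<in>pverts ?H. ?D x * mean_extension (\<lambda>a. mean_extension (g a) y) x))"
      unfolding sum_distrib_left by (subst sum.swap) (simp add: mult_ac)
    also have "\<dots> = ?q * (\<Sum>y\<in>pverts ?H. \<Sum>a\<in>pverts G. ?D y * (?d a * mean_extension (g a) y))"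
      unfolding sum_degree_mean_extension by (simp add: sum_distrib_left mult_ac)
    also have "(\<Sum>y\<in>pverts ?H. \<Sum>a\<in>pverts G. ?D y * (?d a * mean_extension (g a) y))
        = (\<Sum>a\<in>pverts G. ?d a * (\<Sum>y\<in>pverts ?H. ?D y * mean_extension (g a) y))"
      unfolding sum_distrib_left by (subst sum.swap) (simp add: mult_ac)
    also have "\<dots> = ?q * S"
      unfolding sum_degree_mean_extension by (simp add: S_def sum_distrib_left mult_ac)
    finally have main: "(\<Sum>x\<in>pverts ?H. ?D x * (\<Sum>y\<in>pverts ?H. ?D y * mean_extension (\<lambda>a. mean_extension (g a) y) x))
        = ?q\<^sup>2 * S" by (simp add: power2_eq_square)
    have inner: "(\<Sum>y\<in>pverts ?H. ?D y * clique_term n (New e k) y) = (real n - 1) / 2"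
      if "e \<in> uedges G" "k < n - 2" for e k
    proof -
      have "(\<Sum>e'\<in>uedges G. \<Sum>j<n - 2. clique_term n (New e k) (New e' j))
          = (\<Sum>e'\<in>uedges G. of_bool (e = e') * (1 / 2))"
        by (simp only: clique_term.simps sum_distrib_left[symmetric] sum_clique_term[OF that(2)])
      also have "\<dots> = (\<Sum>e'\<in>uedges G. if e = e' then 1 / 2 else 0)"
        by (intro sum.cong) auto
      also have "\<dots> = 1 / 2" using that by simp
      finally show ?thesis by (simp add: sum_degree_CL)
    qed
    have "(\<Sum>x\<in>pverts ?H. ?D x * (\<Sum>y\<in>pverts ?H. ?D y * clique_term n x y))
        = (real n - 1) * (\<Sum>e\<in>uedges G. \<Sum>k<n - 2. (real n - 1) / 2)"
      by (subst sum_degree_CL) (simp add: inner)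
    also have "\<dots> = (real n - 1)\<^sup>2 * (real n - 2) / 2 * E"
      by (simp add: real_n_diff E_def power2_eq_square)
    finally show ?thesis using split main by simp
  qed

  have size: "(\<Sum>x\<in>pverts ?H. ?D x) = real n * (real n - 1) * E"
    using pair_graph.handshake[OF pair_graph_CL] card_uedges_CL by (simp add: E_def)
  have "Kf_mult ?H = real n * (real n - 1) * E *
      ((real n - 1) * (T - (real n - 2) * (N - 1) / (2 * real n) + 3 * (real n - 2) * E / (2 * real n)))
      - (2 / real n * ?q\<^sup>2 * S + (real n - 1)\<^sup>2 * (real n - 2) / 2 * E)"
    unfolding pair_graph.Kf_mult_green[OF pair_graph_CL green_CL[OF green]] size trace total ..
  also have "\<dots> = real n * (real n - 1)\<^sup>2 / 2 * (2 * E * T - S)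
      - (real n - 1)\<^sup>2 * (real n - 2) / 2 * E * N + 3 * (real n - 1)\<^sup>2 * (real n - 2) / 2 * E\<^sup>2"
    using n0 by (simp add: field_simps power2_eq_square)
  finally show ?thesis by (simp only: KfG E_def N_def)
qed

end

section \<open>The embedded initial graph\<close>

lemma nbrs_CL_iter_0: "nbrs (CL_iter n 0 G) (Base a) = Base ` nbrs G a"
  by (auto simp: nbrs_def)

lemma laplacian_CL_iter_0:
  "laplacian (CL_iter n 0 G) f (Base a) = laplacian G (\<lambda>b. f (Base b)) a"
  by (simp add: laplacian_def nbrs_CL_iter_0 sum.reindex inj_on_def del: CL_iter.simps)

context pair_graph
begin

lemma pair_graph_CL_iter_0: "pair_graph (CL_iter n 0 G)"
proof
  show "symmetric (with_proj (CL_iter n 0 G))"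
    using pair_sym_arcs by (force simp: symmetric_def sym_def)
qed (use pair_no_loops in \<open>auto simp: pair_finite_verts pair_finite_arcs dest: in_arcsD1 in_arcsD2\<close>)

text \<open>
  The embedding \<open>Base\<close> is an isomorphism onto its image, along which the Green function is carried
  over.
\<close>

lemma green_CL_iter_0:
  assumes "green_function G z g"
  shows "green_function (CL_iter n 0 G) (Base z) (\<lambda>x y. g (the_inv Base x) (the_inv Base y))"
proof -
  have "the_inv Base (Base a :: 'a clvertex) = a" for a
    by (rule the_inv_f_f) (simp add: inj_on_def)
  then show ?thesis
    using assms by (auto simp: green_function_def laplacian_CL_iter_0 simp del: CL_iter.simps)
      (auto simp: laplacian_CL_iter_0[simplified])
qed

lemma card_pverts_CL_iter_0: "card (pverts (CL_iter n 0 G)) = card (pverts G)"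
  by (simp add: card_image inj_on_def)

lemma vertex_degree_CL_iter_0: "vertex_degree (CL_iter n 0 G) (Base a) = vertex_degree G a"
  unfolding vertex_degree_nbrs nbrs_CL_iter_0 by (simp add: card_image inj_on_def)

lemma sum_CL_iter_0: "(\<Sum>x\<in>pverts (CL_iter n 0 G). F x) = (\<Sum>a\<in>pverts G. F (Base a))"
  by (simp add: sum.reindex inj_on_def)

lemma card_uedges_CL_iter_0: "card (uedges (CL_iter n 0 G)) = card (uedges G)"
  using pair_graph.handshake[OF pair_graph_CL_iter_0, of n] handshake
  by (simp only: sum_CL_iter_0 vertex_degree_CL_iter_0)

lemma Kf_mult_CL_iter_0:
  assumes "green_function G z g"
  shows "Kf_mult (CL_iter n 0 G) = Kf_mult G"
proof -
  have "the_inv Base (Base a :: 'a clvertex) = a" for a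
    by (rule the_inv_f_f) (simp add: inj_on_def)
  then show ?thesis
    unfolding Kf_mult_green[OF assms] sum_CL_iter_0 vertex_degree_CL_iter_0
      pair_graph.Kf_mult_green[OF pair_graph_CL_iter_0 green_CL_iter_0[OF assms]] by simp
qed

end

section \<open>Solving the recursion\<close>

text \<open>
  The three identities below are pure algebra: one step of the recursions for the index and for the
  number of vertices applied to the closed form, and the passage from the closed form to the exponents
  \<open>r - 1\<close>. The letters \<open>A\<close> and \<open>B\<close> stand for $(n-1)^r$ and $(n/2)^r$, and \<open>X\<close>, \<open>Y\<close>, \<open>Z\<close> for the powers
  of $n-1$, $n$ and $2$ with exponent $r-1$.
\<close>

lemma Kf_recursion:
  fixes m A B K E N :: real
  assumes "m \<noteq> 0" "m + 1 \<noteq> 0"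
  shows "m * (m - 1)\<^sup>2 / 2 * (A\<^sup>2 * B * K - (m - 1) / m * A * (A - 1) * B * E * N
        + 2 / m * B * (3 * A\<^sup>2 * (B - 1)
            - (2 * A\<^sup>2 * B + (m - 1) * A - (m + 1) * A\<^sup>2) / (m + 1)) * E\<^sup>2)
    - (m - 1)\<^sup>2 * (m - 2) / 2 * (A * B * E) * (N + 2 * (A * B - 1) / (m + 1) * E)
    + 3 * (m - 1)\<^sup>2 * (m - 2) / 2 * (A * B * E)\<^sup>2
   = ((m - 1) * A)\<^sup>2 * (m / 2 * B) * K
        - (m - 1) / m * ((m - 1) * A) * ((m - 1) * A - 1) * (m / 2 * B) * E * N
        + 2 / m * (m / 2 * B) * (3 * ((m - 1) * A)\<^sup>2 * (m / 2 * B - 1)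
            - (2 * ((m - 1) * A)\<^sup>2 * (m / 2 * B) + (m - 1) * ((m - 1) * A)
                - (m + 1) * ((m - 1) * A)\<^sup>2) / (m + 1)) * E\<^sup>2"
  using assms by (simp add: divide_simps) (simp add: algebra_simps power2_eq_square power3_eq_cube)

lemma order_recursion:
  fixes m A B E N :: real
  assumes "m \<noteq> 0" "m + 1 \<noteq> 0"
  shows "(N + 2 * (A * B - 1) / (m + 1) * E) + (m - 2) * (A * B * E)
    = N + 2 * ((m - 1) * A * (m / 2 * B) - 1) / (m + 1) * E"
  using assms by (simp add: divide_simps) (simp add: algebra_simps power2_eq_square power3_eq_cube)

lemma closed_form_rearranged:
  fixes m X Y Z K E N :: real
  assumes "m \<noteq> 0" "m + 1 \<noteq> 0" "m - 1 \<noteq> 0" "X \<noteq> 0" "Z \<noteq> 0"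
  shows "((m - 1) * X)\<^sup>2 * (m * Y / (2 * Z)) * K
        - (m - 1) / m * ((m - 1) * X) * ((m - 1) * X - 1) * (m * Y / (2 * Z)) * E * N
        + 2 / m * (m * Y / (2 * Z)) * (3 * ((m - 1) * X)\<^sup>2 * (m * Y / (2 * Z) - 1)
            - (2 * ((m - 1) * X)\<^sup>2 * (m * Y / (2 * Z)) + (m - 1) * ((m - 1) * X)
                - (m + 1) * ((m - 1) * X)\<^sup>2) / (m + 1)) * E\<^sup>2
   = m * Y * ((m - 1)\<^sup>2 * X\<^sup>2) / (2 * Z) * K
      - Y * ((m - 1) ^ 3 * X\<^sup>2) / (2 * Z) * (1 - 1 / ((m - 1) * X)) * E * N
      + (m - 1)\<^sup>2 * X\<^sup>2 * Y / Z
          * (3 * (m * Y / (2 * Z) - 1)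
             - 1 / (m + 1) * (m * Y / Z + 1 / X - m - 1)) * E\<^sup>2"
  using assms by (simp add: divide_simps) (simp add: algebra_simps power2_eq_square power3_eq_cube)

context pair_graph
begin

text \<open>
  The closed form is arranged so that no exponent \<open>r - 1\<close> occurs; it then also holds for \<open>r = 0\<close>, which
  serves as the base of the induction.
\<close>

lemma Kf_mult_CL_iter:
  fixes r :: nat
  assumes green: "green_function G z g" and n: "n \<ge> 3"
  defines "E \<equiv> real (card (uedges G))" and "N \<equiv> real (card (pverts G))"
    and "A \<equiv> (real n - 1) ^ r" and "B \<equiv> (real n / 2) ^ r"
  shows "pair_graph (CL_iter n r G) \<and> (\<exists>z g. green_function (CL_iter n r G) z g)
    \<and> real (card (uedges (CL_iter n r G))) = A * B * E
    \<and> real (card (pverts (CL_iter n r G))) = N + 2 * (A * B - 1) / (real n + 1) * E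
    \<and> Kf_mult (CL_iter n r G) = A\<^sup>2 * B * Kf_mult G
        - (real n - 1) / real n * A * (A - 1) * B * E * N
        + 2 / real n * B * (3 * A\<^sup>2 * (B - 1)
            - (2 * A\<^sup>2 * B + (real n - 1) * A - (real n + 1) * A\<^sup>2) / (real n + 1)) * E\<^sup>2"
  unfolding A_def B_def
proof (induction r)
  case 0
  then show ?case
    using pair_graph_CL_iter_0 green_CL_iter_0[OF green] Kf_mult_CL_iter_0[OF green]
    by (auto simp: E_def N_def card_pverts_CL_iter_0 card_uedges_CL_iter_0 simp del: CL_iter.simps)
next
  case (Suc r)
  define A B where "A = (real n - 1) ^ r" and "B = (real n / 2) ^ r"
  define K where "K = Kf_mult G"
  let ?H = "CL_iter n r G"
  from Suc obtain w h where h: "green_function ?H w h" and "pair_graph ?H"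
    and E': "real (card (uedges ?H)) = A * B * E"
    and N': "real (card (pverts ?H)) = N + 2 * (A * B - 1) / (real n + 1) * E"
    and K': "Kf_mult ?H = A\<^sup>2 * B * K - (real n - 1) / real n * A * (A - 1) * B * E * N
        + 2 / real n * B * (3 * A\<^sup>2 * (B - 1)
            - (2 * A\<^sup>2 * B + (real n - 1) * A - (real n + 1) * A\<^sup>2) / (real n + 1)) * E\<^sup>2"
    unfolding A_def B_def K_def by blast
  interpret H: clique_blowup ?H n
    using \<open>pair_graph ?H\<close> n by (simp add: clique_blowup_def clique_blowup_axioms_def)
  have A_Suc: "(real n - 1) ^ Suc r = (real n - 1) * A" and B_Suc: "(real n / 2) ^ Suc r = real n / 2 * B"
    by (simp_all add: A_def B_def)
  have n0: "real n \<noteq> 0" "real n + 1 \<noteq> 0" using n by simp_all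
  have "Kf_mult (CL n ?H) = ((real n - 1) * A)\<^sup>2 * (real n / 2 * B) * K
        - (real n - 1) / real n * ((real n - 1) * A) * ((real n - 1) * A - 1) * (real n / 2 * B) * E * N
        + 2 / real n * (real n / 2 * B) * (3 * ((real n - 1) * A)\<^sup>2 * (real n / 2 * B - 1)
            - (2 * ((real n - 1) * A)\<^sup>2 * (real n / 2 * B) + (real n - 1) * ((real n - 1) * A)
                - (real n + 1) * ((real n - 1) * A)\<^sup>2) / (real n + 1)) * E\<^sup>2"
    unfolding H.Kf_mult_CL[OF h] E' N' K' by (rule Kf_recursion[OF n0])
  moreover have "real (card (pverts (CL n ?H)))
      = N + 2 * ((real n - 1) * A * (real n / 2 * B) - 1) / (real n + 1) * E"
    unfolding H.card_pverts_CL E' N' by (rule order_recursion[OF n0])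
  moreover have "real (card (uedges (CL n ?H))) = (real n - 1) * A * (real n / 2 * B) * E"
    unfolding H.card_uedges_CL E' by simp
  ultimately show ?case
    unfolding A_Suc B_Suc CL_iter.simps K_def[symmetric]
    using H.pair_graph_CL H.green_CL[OF h] by blast
qed

end

theorem theorem4p2:
  fixes G :: "'a pair_pre_digraph" and n r :: nat and N\<^sub>0 E\<^sub>0 :: real
  assumes "n \<ge> 3" and "r \<ge> 1"
    and "pair_graph G" and "Digraph_Component.connected (with_proj G)"
    and "N\<^sub>0 = real (card (pverts G))" and "E\<^sub>0 = real (card (uedges G))"
  shows "Kf_mult (CL_iter n r G) =
      real n ^ r * (real n - 1) ^ (2 * r) / 2 ^ r * Kf_mult G
      - real n ^ (r - 1) * (real n - 1) ^ (2 * r + 1) / 2 ^ r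
          * (1 - 1 / (real n - 1) ^ r) * E\<^sub>0 * N\<^sub>0
      + (real n - 1) ^ (2 * r) * real n ^ (r - 1) / 2 ^ (r - 1)
          * (3 * (real n ^ r / 2 ^ r - 1)
             - 1 / (real n + 1)
                 * (real n ^ r / 2 ^ (r - 1) + 1 / (real n - 1) ^ (r - 1) - real n - 1))
          * E\<^sub>0\<^sup>2"
proof -
  interpret pair_graph G by fact
  obtain z g where green: "green_function G z g" using green_exists[OF assms(4)] by blast
  obtain s where r: "r = Suc s" using assms(2) by (cases r) auto
  define X Y Z where "X = (real n - 1) ^ s" and "Y = real n ^ s" and "Z = (2::real) ^ s"
  have nz: "real n \<noteq> 0" "real n + 1 \<noteq> 0" "real n - 1 \<noteq> 0" using assms(1) by simp_all
  have XZ: "X \<noteq> 0" "Z \<noteq> 0" using nz by (simp_all add: X_def Z_def)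
  have powers: "(real n - 1) ^ r = (real n - 1) * X" "(real n / 2) ^ r = real n * Y / (2 * Z)"
    "real n ^ r = real n * Y" "real n ^ (r - 1) = Y" "(2::real) ^ r = 2 * Z" "(2::real) ^ (r - 1) = Z"
    "(real n - 1) ^ (r - 1) = X"
    by (simp_all add: r X_def Y_def Z_def power_divide)
  have "(real n - 1) ^ (2 * r) = ((real n - 1) ^ r)\<^sup>2"
    by (simp add: power_mult[symmetric] mult.commute)
  then have even_powers: "(real n - 1) ^ (2 * r) = (real n - 1)\<^sup>2 * X\<^sup>2"
    "(real n - 1) ^ (2 * r + 1) = (real n - 1) ^ 3 * X\<^sup>2"
    by (simp_all add: powers power_mult_distrib power3_eq_cube power2_eq_square)
  have "Kf_mult (CL_iter n r G) = ((real n - 1) * X)\<^sup>2 * (real n * Y / (2 * Z)) * Kf_mult G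
        - (real n - 1) / real n * ((real n - 1) * X) * ((real n - 1) * X - 1) * (real n * Y / (2 * Z)) * E\<^sub>0 * N\<^sub>0
        + 2 / real n * (real n * Y / (2 * Z)) * (3 * ((real n - 1) * X)\<^sup>2 * (real n * Y / (2 * Z) - 1)
            - (2 * ((real n - 1) * X)\<^sup>2 * (real n * Y / (2 * Z)) + (real n - 1) * ((real n - 1) * X)
                - (real n + 1) * ((real n - 1) * X)\<^sup>2) / (real n + 1)) * E\<^sub>0\<^sup>2"
    using Kf_mult_CL_iter[OF green assms(1), of r]
    unfolding powers assms(5)[symmetric] assms(6)[symmetric] by blast
  then show ?thesis
    unfolding closed_form_rearranged[OF nz XZ] powers even_powers .
qed

end
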